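(* Let $G$ be a finite abstract simplicial complex and let $L$ be its connection matrix, the matrix indexed by $G\times G$ with $L(x,y)=1$ if $x\cap y\ne\emptyset$ and $L(x,y)=0$ otherwise. Then $\det(L)=\phi(G)\in\{-1,1\}$, where $\phi(G)=\prod_{x\in G}\omega(x)$.
   Context: A finite abstract simplicial complex $G$ is a finite set of non-empty finite sets closed under taking non-empty subsets. For $x\in G$, $\dim(x)=|x|-1$ and $\omega(x)=(-1)^{\dim(x)}$. Equivalently $L(x,y)=\chi(C(x)\cap C(y))$ with $C(x)=\{y\in G: y\subset x\}$ and $\chi(A)=\sum_{x\in A}\omega(x)$ for $A\subset G$. *)

theory Defs
  imports "Jordan_Normal_Form.Determinant"
begin

definition finite_simplicial_complex :: "'a set set \<Rightarrow> bool" where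
  "finite_simplicial_complex G \<longleftrightarrow>
     finite G \<and>
     (\<forall>x\<in>G. finite x \<and> x \<noteq> {}) \<and>
     (\<forall>x\<in>G. \<forall>y. y \<subseteq> x \<and> y \<noteq> {} \<longrightarrow> y \<in> G)"

(* Truncated subtraction is harmless: simplices are finite and non-empty. *)
definition simplex_dim :: "'a set \<Rightarrow> nat" where
  "simplex_dim x = card x - 1"

definition \<omega> :: "'a set \<Rightarrow> int" where
  "\<omega> x = (- 1) ^ simplex_dim x"

definition \<phi> :: "'a set set \<Rightarrow> int" where
  "\<phi> G = (\<Prod>x\<in>G. \<omega> x)"

definition connection :: "'a set \<Rightarrow> 'a set \<Rightarrow> int" where
  "connection x y = (if x \<inter> y \<noteq> {} then 1 else 0)"

(* Matrices of the library are indexed by {0..<n}; the G-by-G matrix is therefore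
   written with respect to an enumeration xs of G, i.e. a distinct list with
   set xs = G.  The same enumeration is used for rows and columns. *)
definition connection_matrix :: "'a set list \<Rightarrow> int mat" where
  "connection_matrix xs =
     mat (length xs) (length xs) (\<lambda>(i, j). connection (xs ! i) (xs ! j))"

end

theory Submission imports Defs begin

text \<open>The Euler characteristic of a non-empty simplex is 1, so
  \<open>L(x,y) = \<Sum> {\<omega> z | z \<in> G, z \<subseteq> x \<inter> y}\<close>; that is, \<open>L = Z D Z\<^sup>T\<close>, where \<open>Z(x,z) = 1\<close> if
  \<open>z \<subseteq> x\<close> and \<open>0\<close> otherwise, and \<open>D\<close> is the diagonal matrix of the \<open>\<omega> z\<close>. The matrix \<open>Z\<close> is
  triangular with unit diagonal with respect to inclusion.\<close>

text \<open>Triangularity is with respect to a rank function, so no sorting of the rows is needed: in the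
  Leibniz formula a permutation \<open>p \<noteq> id\<close> would have to strictly decrease the sum of the ranks.\<close>

lemma det_rank_triangular:
  fixes A :: "'a::comm_ring_1 mat" and f :: "nat \<Rightarrow> nat"
  assumes A: "A \<in> carrier_mat n n"
    and tri: "\<And>i j. i < n \<Longrightarrow> j < n \<Longrightarrow> i \<noteq> j \<Longrightarrow> A $$ (i, j) \<noteq> 0 \<Longrightarrow> f j < f i"
  shows "det A = (\<Prod>i<n. A $$ (i, i))"
proof -
  have zero: "(\<Prod>i = 0..<n. A $$ (i, p i)) = 0"
    if p: "p permutes {0..<n}" and ne: "p \<noteq> id" for p
  proof (rule ccontr)
    assume nz: "(\<Prod>i = 0..<n. A $$ (i, p i)) \<noteq> 0"
    have lt: "p i < n" if "i < n" for i
      using permutes_in_image[OF p, of i] that by simp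
    have ent: "A $$ (i, p i) \<noteq> 0" if "i < n" for i
      using nz that prod_zero[of "{0..<n}" "\<lambda>i. A $$ (i, p i)"] by fastforce
    have less: "f (p i) < f i" if "i < n" "p i \<noteq> i" for i
      using tri[of i "p i"] ent lt that by auto
    have le: "f (p i) \<le> f i" if "i < n" for i
      using less[OF that] by (cases "p i = i") auto
    obtain j where j: "p j \<noteq> j"
      using ne by (auto simp: fun_eq_iff)
    then have "j < n"
      using permutes_not_in[OF p, of j] by auto
    then have "(\<Sum>i = 0..<n. f (p i)) < (\<Sum>i = 0..<n. f i)"
      using le less[of j] j by (intro sum_strict_mono_ex1) auto
    moreover have "(\<Sum>i = 0..<n. f (p i)) = (\<Sum>i = 0..<n. f i)"
      using sum.permute[OF p, of f] by (simp add: o_def)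
    ultimately show False by simp
  qed
  have "det A = (\<Sum>p | p permutes {0..<n}. signof p * (\<Prod>i = 0..<n. A $$ (i, p i)))"
    by (rule det_def'[OF A])
  also have "\<dots> = (\<Sum>p\<in>{id}. signof p * (\<Prod>i = 0..<n. A $$ (i, p i)))"
    by (rule sum.mono_neutral_right) (auto simp: finite_permutations permutes_id zero)
  also have "\<dots> = (\<Prod>i<n. A $$ (i, i))"
    by (simp add: lessThan_atLeast0)
  finally show ?thesis .
qed

text \<open>Expand the product of \<open>1 - 1\<close> over \<open>A\<close>: each subset
  contributes one sign, and the product vanishes because \<open>A\<close> has at least one
  factor.\<close>

lemma sum_Pow_minus_one:
  assumes "finite A" "A \<noteq> {}"
  shows "(\<Sum>z\<in>Pow A. (- 1) ^ card z) = (0::int)"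
  using prod_diff_conv_sum[OF assms(1), of "\<lambda>_. 1" "\<lambda>_. 1"] assms
  by (simp add: power_0_left card_eq_0_iff)

text \<open>The nonzero case says that a full simplex has Euler characteristic 1. Up to a global
  sign it is the alternating sum over all subsets, which vanishes, with the term of the empty set
  removed.\<close>

lemma sum_\<omega>_nonempty_subsets:
  assumes A: "finite A"
  shows "(\<Sum>z\<in>Pow A - {{}}. \<omega> z) = (if A \<noteq> {} then 1 else 0)"
proof (cases "A = {}")
  case False
  have "(\<Sum>z\<in>Pow A - {{}}. \<omega> z) = - (\<Sum>z\<in>Pow A - {{}}. (- 1) ^ card z)"
    unfolding sum_negf[symmetric]
  proof (rule sum.cong[OF refl])
    fix z assume "z \<in> Pow A - {{}}"
    \<comment> \<open>Non-emptiness makes \<open>card z - 1\<close> a true predecessor, so the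
      exponent drops by one and the sign flips.\<close>
    then have "card z \<noteq> 0"
      using A by (auto simp: card_eq_0_iff dest: finite_subset)
    then show "\<omega> z = - ((- 1) ^ card z)"
      by (cases "card z") (auto simp: \<omega>_def simplex_dim_def)
  qed
  also have "\<dots> = 1 - (\<Sum>z\<in>Pow A. (- 1) ^ card z)"
    using A by (subst sum.remove[of "Pow A" "{}"]) auto
  finally show ?thesis
    using sum_Pow_minus_one[OF A False] False by simp
qed simp

text \<open>Closure of \<open>G\<close> under non-empty subsets identifies the simplices of
  \<open>G\<close> lying in both \<open>x\<close> and \<open>y\<close> with the non-empty subsets of
  \<open>x \<inter> y\<close>, whose signs sum to the intersection indicator.\<close>

lemma connection_eq_sum:
  assumes G: "finite_simplicial_complex G" and x: "x \<in> G"
  shows "connection x y = (\<Sum>z\<in>G. if z \<subseteq> x \<and> z \<subseteq> y then \<omega> z else 0)"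
proof -
  have fin: "finite G" "finite (x \<inter> y)"
    and sub: "\<And>z. z \<in> G \<Longrightarrow> z \<noteq> {}" "\<And>z. z \<subseteq> x \<Longrightarrow> z \<noteq> {} \<Longrightarrow> z \<in> G"
    using G x unfolding finite_simplicial_complex_def by blast+
  have "connection x y = (\<Sum>z\<in>Pow (x \<inter> y) - {{}}. \<omega> z)"
    by (simp only: sum_\<omega>_nonempty_subsets[OF fin(2)] connection_def)
  also have "Pow (x \<inter> y) - {{}} = {z \<in> G. z \<subseteq> x \<and> z \<subseteq> y}"
    using sub by blast
  also have "(\<Sum>z\<in>{z \<in> G. z \<subseteq> x \<and> z \<subseteq> y}. \<omega> z)
      = (\<Sum>z\<in>G. if z \<subseteq> x \<and> z \<subseteq> y then \<omega> z else 0)"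
    by (rule sum.inter_filter[OF fin(1)])
  finally show ?thesis .
qed

theorem mainTheorem6:
  fixes G :: "'a set set" and xs :: "'a set list"
  assumes "finite_simplicial_complex G"
    and "distinct xs" and "set xs = G"
  shows "det (connection_matrix xs) = \<phi> G \<and> \<phi> G \<in> {- 1, 1}"
proof
  define n where "n = length xs"
  define Z :: "int mat" where "Z = mat n n (\<lambda>(i, k). if xs ! k \<subseteq> xs ! i then 1 else 0)"
  \<comment> \<open>\<open>W\<close> is \<open>Z\<close> with column \<open>k\<close> scaled by
    \<omega> of \<open>xs ! k\<close>, that is, the product of \<open>Z\<close> and the diagonal
    factor; it is triangular for the same rank.\<close>
  define W where "W = mat n n (\<lambda>(i, k). if xs ! k \<subseteq> xs ! i then \<omega> (xs ! k) else 0)"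
  have Z: "Z \<in> carrier_mat n n" and W: "W \<in> carrier_mat n n"
    by (simp_all add: Z_def W_def)
  have bij: "bij_betw ((!) xs) {..<n} G"
    using assms(2,3) by (intro bij_betw_nth) (auto simp: n_def)
  have mem: "xs ! i \<in> G" if "i < n" for i
    using that assms(3) by (auto simp: n_def)
  \<comment> \<open>Cardinality is the rank: distinctness of \<open>xs\<close> makes inclusion at
    different indices strict.\<close>
  have rank: "card (xs ! k) < card (xs ! i)"
    if "i < n" "k < n" "i \<noteq> k" "xs ! k \<subseteq> xs ! i" for i k
  proof (rule psubset_card_mono)
    show "finite (xs ! i)"
      using assms(1) mem[OF that(1)] by (auto simp: finite_simplicial_complex_def)
    show "xs ! k \<subset> xs ! i"
      using that assms(2) by (auto simp: psubset_eq nth_eq_iff_index_eq n_def)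
  qed
  have "det Z = (\<Prod>i<n. Z $$ (i, i))"
    by (rule det_rank_triangular[OF Z, where f = "\<lambda>i. card (xs ! i)"])
      (auto simp: Z_def intro!: rank split: if_splits)
  then have detZ: "det Z = 1"
    by (simp add: Z_def)
  have "det W = (\<Prod>i<n. W $$ (i, i))"
    by (rule det_rank_triangular[OF W, where f = "\<lambda>i. card (xs ! i)"])
      (auto simp: W_def intro!: rank split: if_splits)
  also have "\<dots> = (\<Prod>i<n. \<omega> (xs ! i))"
    by (simp add: W_def)
  also have "\<dots> = \<phi> G"
    unfolding \<phi>_def by (rule prod.reindex_bij_betw[OF bij])
  finally have detW: "det W = \<phi> G" .
  have "connection_matrix xs = W * Z\<^sup>T"
  proof (rule eq_matI)
    fix i j assume "i < dim_row (W * Z\<^sup>T)" "j < dim_col (W * Z\<^sup>T)"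
    then have ij: "i < n" "j < n"
      by (simp_all add: W_def Z_def)
    have "connection (xs ! i) (xs ! j)
        = (\<Sum>k<n. if xs ! k \<subseteq> xs ! i \<and> xs ! k \<subseteq> xs ! j then \<omega> (xs ! k) else 0)"
      unfolding connection_eq_sum[OF assms(1) mem[OF ij(1)]]
      by (rule sum.reindex_bij_betw[OF bij, symmetric])
    also have "\<dots> = (W * Z\<^sup>T) $$ (i, j)"
      \<comment> \<open>Entry \<open>k\<close> of row \<open>i\<close> of \<open>W\<close> times
        entry \<open>k\<close> of row \<open>j\<close> of \<open>Z\<close> combines the two
        inclusion tests into their conjunction.\<close>
      using ij by (auto simp: W_def Z_def scalar_prod_def lessThan_atLeast0 intro!: sum.cong)
    finally show "connection_matrix xs $$ (i, j) = (W * Z\<^sup>T) $$ (i, j)"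
      using ij by (simp add: connection_matrix_def n_def)
  qed (simp_all add: connection_matrix_def W_def Z_def n_def)
  then show "det (connection_matrix xs) = \<phi> G"
    using det_mult[OF W, of "Z\<^sup>T"] Z det_transpose[OF Z] detZ detW by simp
next
  have "\<bar>\<phi> G\<bar> = 1"
    by (simp add: \<phi>_def \<omega>_def abs_prod power_abs)
  then show "\<phi> G \<in> {- 1, 1}"
    by auto
qed

end
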